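(* Every countable subgroup $G$ of the additive group $(\mathbb{R},+)$ (with the usual topology) is compactly generated.
   Context: A subgroup $G$ of a topological group is compactly generated if there is a compact set $C\subseteq G$ (compact in the subspace topology) such that $G$ is the subgroup generated by $C$. *)

theory Defs
  imports "HOL-Analysis.Analysis" "HOL-Algebra.Generated_Groups"
begin

definition additive_group :: "'a::group_add monoid"
  where "additive_group = \<lparr>carrier = UNIV, mult = (+), one = 0\<rparr>"

lemma carrier_additive_group [simp]: "carrier additive_group = UNIV"
  and mult_additive_group [simp]: "x \<otimes>\<^bsub>additive_group\<^esub> y = x + y"
  and one_additive_group [simp]: "\<one>\<^bsub>additive_group\<^esub> = 0"
  by (simp_all add: additive_group_def)

lemma group_additive_group [simp]: "group additive_group"
proof (rule groupI)
  fix x :: 'a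
  show "\<exists>y\<in>carrier additive_group. y \<otimes>\<^bsub>additive_group\<^esub> x = \<one>\<^bsub>additive_group\<^esub>"
    by (rule bexI [of _ "- x"]) simp_all
qed (simp_all add: add.assoc)

lemma inv_additive_group [simp]: "inv\<^bsub>additive_group\<^esub> x = - x"
  by (rule group.inv_equality [OF group_additive_group]) simp_all

text \<open>
  Intended for subgroups \<open>G\<close> of the additive group.
  Compactness is taken in the subspace topology of \<open>G\<close>.
\<close>

definition compactly_generated :: "'a::topological_group_add set \<Rightarrow> bool"
  where "compactly_generated G \<longleftrightarrow>
    (\<exists>C\<subseteq>G. compactin (top_of_set G) C \<and> generate additive_group C = G)"

end

(* If G has no positive elements close to 0, it is closed, and for any positive a in G the compact
   set G \<inter> [0, a] generates G by division with remainder.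
   Otherwise enumerate G as g 0, g 1, ... and choose h n in G with 0 < h n < 1 / (n + 1). Dividing
   g n by h n leaves a remainder r n in G with 0 \<le> r n < h n. The sequences h and r tend to 0, so
   together with 0 they form a compact set, and it generates every g n. *)

theory Submission
  imports Defs
begin

lemma subgroup_additive_groupD:
  assumes "subgroup H additive_group"
  shows "0 \<in> H" "x \<in> H \<Longrightarrow> y \<in> H \<Longrightarrow> x + y \<in> H" "x \<in> H \<Longrightarrow> - x \<in> H"
    "x \<in> H \<Longrightarrow> y \<in> H \<Longrightarrow> x - y \<in> H"
proof -
  show "0 \<in> H" and add: "x \<in> H \<Longrightarrow> y \<in> H \<Longrightarrow> x + y \<in> H" for x y
    using subgroup.one_closed[OF assms] subgroup.m_closed[OF assms] by simp_all
  show neg: "x \<in> H \<Longrightarrow> - x \<in> H" for x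
    using subgroup.m_inv_closed[OF assms] by fastforce
  show "x \<in> H \<Longrightarrow> y \<in> H \<Longrightarrow> x - y \<in> H"
    using add[of x "- y"] neg[of y] by simp
qed

text \<open>Integer multiples are written as ring products so that a quotient given by
  \<open>floor\<close> can be used directly. The induction runs both ways from 0.\<close>

lemma subgroup_of_int_mult:
  fixes a :: "'a::ring_1"
  assumes H: "subgroup H additive_group" and a: "a \<in> H"
  shows "of_int k * a \<in> H"
proof (induction k rule: int_induct[where k = 0])
  case base
  then show ?case using subgroup_additive_groupD(1)[OF H] by simp
next
  case (step1 i)
  then show ?case using subgroup_additive_groupD(2)[OF H _ a] by (simp add: distrib_right)
next
  case (step2 i)
  then show ?case using subgroup_additive_groupD(4)[OF H _ a] by (simp add: left_diff_distrib)
qed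

lemma subgroup_generate_additive_group: "subgroup (generate additive_group C) additive_group"
  by (rule group.generate_is_subgroup) simp_all

text \<open>A subset of \<open>G\<close> is compact in the subspace topology iff it is compact in
  the ambient space. The other inclusion follows from \<open>C \<subseteq> G\<close>, as
  \<open>G\<close> is a subgroup.\<close>

lemma compactly_generatedI:
  assumes "subgroup G additive_group" "C \<subseteq> G" "compact C" "G \<subseteq> generate additive_group C"
  shows "compactly_generated G"
  unfolding compactly_generated_def
  using assms group.generate_subgroup_incl[OF group_additive_group assms(2,1)]
  by (auto simp: compactin_subtopology)

definition remainder :: "real \<Rightarrow> real \<Rightarrow> real"
  where "remainder x a = x - of_int \<lfloor>x / a\<rfloor> * a"

lemma remainder_bounds:
  assumes "a > 0"
  shows "0 \<le> remainder x a" "remainder x a < a"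
  using floor_divide_lower[OF assms, of x] floor_divide_upper[OF assms, of x]
  by (simp_all add: remainder_def algebra_simps)

lemma remainder_in_subgroup:
  assumes "subgroup G additive_group" "x \<in> G" "a \<in> G"
  shows "remainder x a \<in> G"
  unfolding remainder_def
  using assms by (intro subgroup_additive_groupD(4) subgroup_of_int_mult)

text \<open>Here x is its remainder plus an integer multiple of a. Both cases of the theorem obtain
  generation from this.\<close>

lemma in_generate_remainder:
  assumes "a \<in> C" "remainder x a \<in> C"
  shows "x \<in> generate additive_group C"
proof -
  note H = subgroup_generate_additive_group[of C]
  have "remainder x a + of_int \<lfloor>x / a\<rfloor> * a \<in> generate additive_group C"
    using assms
    by (intro subgroup_additive_groupD(2)[OF H] subgroup_of_int_mult[OF H]) (auto intro: generate.incl)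
  then show ?thesis by (simp add: remainder_def)
qed

lemma compactly_generated_discrete:
  fixes G :: "real set"
  assumes G: "subgroup G additive_group" and "e > 0" and gap: "\<And>h. h \<in> G \<Longrightarrow> 0 < h \<Longrightarrow> e \<le> h"
  shows "compactly_generated G"
proof (cases "\<exists>a\<in>G. a > 0")
  case False
  then have "x = 0" if "x \<in> G" for x
    using that subgroup_additive_groupD(3)[OF G that] by (metis neg_0_less_iff_less linorder_neqE)
  then show ?thesis
    using subgroup_additive_groupD(1)[OF G]
    by (intro compactly_generatedI[OF G, of "{0}"]) (auto intro: generate.incl)
next
  case True
  then obtain a where a: "a \<in> G" "a > 0" by blast
  \<comment> \<open>If x and y differ, one of x - y and y - x is a positive element of
    \<open>G\<close>, hence at least e. So \<open>G\<close> is uniformly discrete, which makes it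
    closed.\<close>
  have "x = y" if "x \<in> G" "y \<in> G" "dist y x < e" for x y
    using gap[of "x - y"] gap[of "y - x"] subgroup_additive_groupD(4)[OF G] that
    by (force simp: dist_real_def)
  then have "closed G"
    using \<open>e > 0\<close> by (intro discrete_imp_closed[of e]) auto
  then have "compact (G \<inter> {0..a})"
    by (intro closed_Int_compact) auto
  moreover have "x \<in> generate additive_group (G \<inter> {0..a})" if "x \<in> G" for x
    using a that remainder_bounds[of a x]
    by (intro in_generate_remainder[of a]) (auto intro: remainder_in_subgroup[OF G])
  ultimately show ?thesis
    by (intro compactly_generatedI[OF G, of "G \<inter> {0..a}"]) auto
qed

text \<open>Now \<open>G\<close> is dense and countable, so \<open>G \<inter> {0..a}\<close> with a
  > 0 is not closed and cannot serve as the compact set.\<close>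

lemma compactly_generated_countable_dense:
  fixes G :: "real set"
  assumes G: "subgroup G additive_group" and "countable G"
    and small: "\<And>e. e > 0 \<Longrightarrow> \<exists>h\<in>G. 0 < h \<and> h < e"
  shows "compactly_generated G"
proof -
  define g where "g = from_nat_into G"
  have "G \<noteq> {}" using small[of 1] by auto
  then have g: "range g = G"
    unfolding g_def using \<open>countable G\<close> by (rule range_from_nat_into)
  obtain h where h: "h n \<in> G" "0 < h n" "h n < inverse (real (Suc n))" for n
    using small[of "inverse (real (Suc n))" for n] 
    by (metis inverse_positive_iff_positive of_nat_0_less_iff zero_less_Suc)
  define r where "r n = remainder (g n) (h n)" for n
  have r: "r n \<in> G" "0 \<le> r n" "r n < h n" for n
    using h remainder_bounds[of "h n" "g n"] remainder_in_subgroup[OF G, of "g n" "h n"] g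
    by (auto simp: r_def)
  have "h \<longlonglongrightarrow> 0"
    by (rule tendsto_sandwich[OF _ _ tendsto_const LIMSEQ_inverse_real_of_nat])
      (use h in \<open>auto intro!: always_eventually less_imp_le\<close>)
  moreover have "r \<longlonglongrightarrow> 0"
    by (rule tendsto_sandwich[OF _ _ tendsto_const \<open>h \<longlonglongrightarrow> 0\<close>])
      (use r in \<open>auto intro!: always_eventually less_imp_le\<close>)
  \<comment> \<open>A convergent sequence together with its limit is compact; the limit 0 lies in
    \<open>G\<close>.\<close>
  ultimately have "compact (insert 0 (range h) \<union> insert 0 (range r))"
    by (intro compact_Un compact_sequence_with_limit)
  moreover have "g n \<in> generate additive_group (insert 0 (range h) \<union> insert 0 (range r))" for n
    by (rule in_generate_remainder[of "h n"]) (auto simp: r_def)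
  ultimately show ?thesis
    using h r g subgroup_additive_groupD(1)[OF G]
    by (intro compactly_generatedI[OF G, of "insert 0 (range h) \<union> insert 0 (range r)"]) auto
qed

theorem theorem1:
  fixes G :: "real set"
  assumes "subgroup G additive_group"
    and "countable G"
  shows "compactly_generated G"
proof (cases "\<forall>e>0. \<exists>h\<in>G. 0 < h \<and> h < e")
  case True
  then show ?thesis using compactly_generated_countable_dense[OF assms] by blast
next
  case False
  \<comment> \<open>The negated condition yields some e > 0 with no element of \<open>G\<close>
    strictly between 0 and e.\<close>
  then show ?thesis using compactly_generated_discrete[OF assms(1)] by (meson not_less)
qed

end
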